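(* For any integers $d\geq 2$ and $D\geq 2$, the de Bruijn digraph $B(d,D)$ satisfies: 1. $Z(B(d,D))=(d-1)d^{D-1}$; 2. $M(B(d,D))=(d-1)d^{D-1}$; 3. $\mathrm{mr}(B(d,D))=d^{D-1}$; 4. $\gamma_P(B(d,D))=(d-1)d^{D-2}$.
   Context: De Bruijn digraph: $B(d,D)$ has vertex set $\mathbb Z_{d^D}$, and each vertex $x$ has arcs to the vertices $dx+t \pmod{d^D}$, $t\in\{0,\dots,d-1\}$. Equivalently (up to isomorphism), $B(d,1)=K_d$, the complete symmetric digraph of order $d$ with a loop on each vertex (all ordered pairs are arcs), and $B(d,D)=L(B(d,D-1))$ for $D\ge2$. Here the line digraph $L(G)$ has vertex set $\{uv:(u,v)\in A(G)\}$, with an arc from $uv$ to $xy$ exactly when $v=x$. A digraph $H$ has vertex set $V(H)$ and arc set $A(H)\subseteq V(H)\times V(H)$; loops are allowed. $N^+_H(v)=\{u:(v,u)\in A(H)\}$, $N^+_H[v]=N^+_H(v)\cup\{v\}$, $N^+_H[S]=\bigcup_{v\in S}N^+_H[v]$. Zero forcing in a digraph $H$: for non-empty $S\subseteq V(H)$ put $B^0(S)=S$ and, for $i\ge 0$: if $H$ has no loops, $B^{i+1}(S)=B^i(S)\cup\{v\in V(H)\setminus B^i(S):\exists u\in B^i(S),\ N^+_H(u)\setminus B^i(S)=\{v\}\}$; if $H$ has at least one loop, $B^{i+1}(S)=B^i(S)\cup\{v\in V(H)\setminus B^i(S):\exists u\in V(H),\ N^+_H(u)\setminus B^i(S)=\{v\}\}$.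 $S$ is a zero forcing set if $B^m(S)=V(H)$ for some $m\ge 0$. $Z(H)$ is the minimum cardinality of a zero forcing set of $H$. Power domination in $H$: for non-empty $S\subseteq V(H)$ put $P^0(S)=S$, $P^1(S)=N^+_H[S]$, and for $i\geq 1$ obtain $P^{i+1}(S)$ from $P^i(S)$ by the same rule by which $B^{i+1}(S)$ is obtained from $B^i(S)$ (the loopless rule if $H$ has no loops, the other rule if $H$ has at least one loop). $S$ is a power dominating set if $P^t(S)=V(H)$ for some $t\ge 0$. $\gamma_P(H)$ is the minimum cardinality of a power dominating set of $H$. Maximum nullity and minimum rank: for a digraph $H$ of order $p$, let $\mathcal S(H)$ be the set of real $p\times p$ matrices $X$ such that: if $H$ has no loops, for all $i\neq j$, $X_{i,j}\neq 0\Leftrightarrow (i,j)\in A(H)$ (diagonal arbitrary); if $H$ has at least one loop, for all $i,j$, $X_{i,j}\neq 0\Leftrightarrow (i,j)\in A(H)$. $M(H)=\max\{\dim\ker X:X\in\mathcal S(H)\}$ and $\mathrm{mr}(H)=\min\{\operatorname{rank}X:X\in\mathcal S(H)\}$. *)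

theory Defs
  imports
    "Graph_Theory.Pair_Digraph"
    "Jordan_Normal_Form.Matrix_Kernel"
    "Jordan_Normal_Form.DL_Rank"
begin

text \<open>Digraphs without parallel arcs, loops allowed, are the pair digraphs
  \<^typ>\<open>'a pair_pre_digraph\<close> of the library: vertex set \<^const>\<open>pverts\<close> and arc set
  \<^const>\<open>parcs\<close>, a set of ordered pairs. All notions below are meant for finite non-empty
  digraphs with \<^term>\<open>parcs H \<subseteq> pverts H \<times> pverts H\<close>.\<close>

definition has_loop :: "'a pair_pre_digraph \<Rightarrow> bool" where
  "has_loop H \<longleftrightarrow> (\<exists>v \<in> pverts H. (v, v) \<in> parcs H)"

definition out_nbhd :: "'a pair_pre_digraph \<Rightarrow> 'a \<Rightarrow> 'a set" where
  "out_nbhd H v = {u. (v, u) \<in> parcs H}"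

definition closed_out_nbhd :: "'a pair_pre_digraph \<Rightarrow> 'a set \<Rightarrow> 'a set" where
  "closed_out_nbhd H S = (\<Union>v\<in>S. out_nbhd H v \<union> {v})"

definition force_step :: "'a pair_pre_digraph \<Rightarrow> 'a set \<Rightarrow> 'a set" where
  "force_step H B =
    (if has_loop H
     then B \<union> {v \<in> pverts H - B. \<exists>u \<in> pverts H. out_nbhd H u - B = {v}}
     else B \<union> {v \<in> pverts H - B. \<exists>u \<in> B. out_nbhd H u - B = {v}})"

primrec zf_set :: "'a pair_pre_digraph \<Rightarrow> 'a set \<Rightarrow> nat \<Rightarrow> 'a set" where
  "zf_set H S 0 = S"
| "zf_set H S (Suc i) = force_step H (zf_set H S i)"

definition zero_forcing_set :: "'a pair_pre_digraph \<Rightarrow> 'a set \<Rightarrow> bool" where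
  "zero_forcing_set H S \<longleftrightarrow>
    S \<noteq> {} \<and> S \<subseteq> pverts H \<and> (\<exists>m. zf_set H S m = pverts H)"

definition zero_forcing_number :: "'a pair_pre_digraph \<Rightarrow> nat" where
  "zero_forcing_number H = Min {card S | S. zero_forcing_set H S}"

fun pd_set :: "'a pair_pre_digraph \<Rightarrow> 'a set \<Rightarrow> nat \<Rightarrow> 'a set" where
  "pd_set H S 0 = S"
| "pd_set H S (Suc 0) = closed_out_nbhd H S"
| "pd_set H S (Suc (Suc i)) = force_step H (pd_set H S (Suc i))"

definition power_dominating_set :: "'a pair_pre_digraph \<Rightarrow> 'a set \<Rightarrow> bool" where
  "power_dominating_set H S \<longleftrightarrow>
    S \<noteq> {} \<and> S \<subseteq> pverts H \<and> (\<exists>t. pd_set H S t = pverts H)"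

definition power_domination_number :: "'a pair_pre_digraph \<Rightarrow> nat" where
  "power_domination_number H = Min {card S | S. power_dominating_set H S}"

text \<open>Library matrices have rows and columns indexed by initial segments of the natural numbers,
  so the matrices attached to \<open>H\<close> are taken with respect to all enumerations \<open>f\<close> of the
  vertices. Changing \<open>f\<close> permutes rows and columns simultaneously, which affects neither
  rank nor nullity.\<close>

definition matrices_of :: "'a pair_pre_digraph \<Rightarrow> real mat set" where
  "matrices_of H = {X \<in> carrier_mat (card (pverts H)) (card (pverts H)).
    \<exists>f. bij_betw f {..<card (pverts H)} (pverts H) \<and>
      (\<forall>i < card (pverts H). \<forall>j < card (pverts H).
         has_loop H \<or> i \<noteq> j \<longrightarrow> (X $$ (i, j) \<noteq> 0 \<longleftrightarrow> (f i, f j) \<in> parcs H))}"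

definition max_nullity :: "'a pair_pre_digraph \<Rightarrow> nat" where
  "max_nullity H = Max {kernel_dim X | X. X \<in> matrices_of H}"

text \<open>The first argument of \<^const>\<open>vec_space.rank\<close> is the number of rows.\<close>

definition min_rank :: "'a pair_pre_digraph \<Rightarrow> nat" where
  "min_rank H = Min {vec_space.rank (card (pverts H)) X | X. X \<in> matrices_of H}"

text \<open>The residues modulo \<open>d ^ D\<close> are represented by \<open>0, \<dots>, d ^ D - 1\<close>.\<close>

definition de_bruijn :: "nat \<Rightarrow> nat \<Rightarrow> nat pair_pre_digraph" where
  "de_bruijn d D =
    \<lparr> pverts = {..<d ^ D},
      parcs = {(x, (d * x + t) mod d ^ D) | x t. x < d ^ D \<and> t < d} \<rparr>"

lemma de_bruijn_fin_digraph:
  assumes "d > 0"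
  shows "pair_fin_digraph (de_bruijn d D)"
proof
  show "fst e \<in> pverts (de_bruijn d D)" "snd e \<in> pverts (de_bruijn d D)"
    if "e \<in> parcs (de_bruijn d D)" for e
    using that assms by (auto simp: de_bruijn_def)
  then have "parcs (de_bruijn d D) \<subseteq> pverts (de_bruijn d D) \<times> pverts (de_bruijn d D)"
    by force
  moreover show "finite (pverts (de_bruijn d D))"
    by (simp add: de_bruijn_def)
  ultimately show "finite (parcs (de_bruijn d D))"
    using finite_subset by blast
qed

end

theory Submission
  imports Defs
begin

text \<open>Write \<open>N = d ^ D\<close>, \<open>K = d ^ (D - 1)\<close> and \<open>J = d ^ (D - 2)\<close>. The out-neighbourhood of \<open>x\<close>
  is the interval \<open>{d * c..<d * c + d}\<close> with \<open>c = x mod K\<close>, so the out-neighbourhoods are exactly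
  \<open>K\<close> pairwise disjoint blocks of size \<open>d\<close> that partition the vertices.

  The first three values only use such a partition into \<open>K\<close> blocks. Since there is a loop, every
  vertex may force, whether coloured or not. Hence a block that misses one vertex is completed at
  once, and a block that misses two is stuck for ever. So a set is zero forcing iff it misses at
  most one vertex of each block, which gives \<open>Z = N - K\<close>. In a matrix of the digraph, the
  columns of vertices from different blocks have disjoint supports, so the rank is at least \<open>K\<close>; in
  the adjacency matrix the columns of one block coincide, so its rank is at most \<open>K\<close>. Nullity
  follows by rank-nullity.

  For power domination, after the domination step the block \<open>c\<close> is complete if \<open>c\<close> is the
  residue modulo \<open>K\<close> of an element of \<open>S\<close>. So \<open>S\<close> is power dominating iff it is non-empty and contains all
  but at most one vertex of every other block. Let \<open>k\<close> be the number of these other blocks: then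
  \<open>card S \<ge> K - k\<close> and \<open>card S \<ge> (d - 1) * k\<close>, and whichever of \<open>k \<le> J\<close> and \<open>k \<ge> J\<close> holds,
  one of the two bounds is at least \<open>(d - 1) * J\<close>, as \<open>K = d * J\<close>.
  Equality is reached by \<open>J\<close> blocks with \<open>d - 1\<close> elements each, whose residues modulo \<open>K\<close> are
  exactly the indices of all other blocks. Read a block index as a word of length \<open>D - 1\<close> over the digits
  \<open>0, \<dots>, d - 1\<close>; the \<open>J\<close> blocks are the words whose first and last digits agree
  (only the word \<open>0\<close> if \<open>D = 2\<close>).\<close>

section \<open>Rank and nullity of matrices\<close>

context vec_space
begin

lemma rank_plus_kernel_dim:
  assumes A: "A \<in> carrier_mat n nc"
  shows "rank A + kernel_dim A = nc"
proof -
  interpret N: vec_space "TYPE('a)" nc .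
  have hom: "(*\<^sub>v) A \<in> module_hom class_ring N.V V"
    using A unfolding module_hom_def
    by (auto simp: module_vec_simps class_ring_simps mult_add_distrib_mat_vec mult_mat_vec)
  interpret L: linear_map class_ring N.V V "(*\<^sub>v) A"
    by (intro linear_map.intro mod_hom.intro mod_hom_axioms.intro hom vec_vs
        vec_module)
  have "L.imT = span (set (cols A))"
    using col_space_eq[OF A] A unfolding L.im_def col_space_def by (auto simp: image_iff)
  moreover have "L.kerT = mat_kernel A"
    using mat_kernel[OF A] unfolding L.ker_def by auto
  ultimately show ?thesis
    using L.rank_nullity_main(1)[OF N.fin_dim] A N.dim_is_n
    unfolding rank_def kernel_dim_def by simp
qed

lemma rank_le_card_cols:
  assumes "A \<in> carrier_mat n nc"
  shows "rank A \<le> card (set (cols A))"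
proof -
  obtain S where S: "maximal S (\<lambda>T. T \<subseteq> set (cols A) \<and> lin_indpt T)"
    using maximal_exists_superset[of "set (cols A)" "\<lambda>T. T \<subseteq> set (cols A) \<and> lin_indpt T" "{}"]
    by (metis (no_types, lifting) List.finite_set empty_subsetI finite_basis_exists fin_dim
        subset_li_is_li basis_def)
  then have "S \<subseteq> set (cols A)"
    by (simp add: maximal_def)
  then show ?thesis
    using rank_card_indpt[OF assms S] by (simp add: card_mono)
qed

text \<open>Columns with pairwise disjoint non-empty supports are linearly independent: a row in the support
  of one of them isolates its coefficient.\<close>

lemma rank_ge_card_disjoint_cols:
  assumes A: "A \<in> carrier_mat n nc" and J: "J \<subseteq> {..<nc}"
    and nz: "\<And>j. j \<in> J \<Longrightarrow> \<exists>i<n. A $$ (i, j) \<noteq> 0"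
    and disj: "\<And>i j j'. i < n \<Longrightarrow> j \<in> J \<Longrightarrow> j' \<in> J \<Longrightarrow> A $$ (i, j) \<noteq> 0 \<Longrightarrow>
      A $$ (i, j') \<noteq> 0 \<Longrightarrow> j = j'"
  shows "card J \<le> rank A"
proof -
  have ent: "col A j $ i = A $$ (i, j)" if "i < n" "j \<in> J" for i j
    using that A J by auto
  have inj: "inj_on (col A) J"
  proof (rule inj_onI)
    fix j j' assume j: "j \<in> J" "j' \<in> J" and eq: "col A j = col A j'"
    obtain i where i: "i < n" "A $$ (i, j) \<noteq> 0"
      using nz j by blast
    then have "A $$ (i, j') \<noteq> 0"
      using ent[OF i(1) j(1)] ent[OF i(1) j(2)] eq by simp
    then show "j = j'"
      using disj i j by blast
  qed
  have fin: "finite J"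
    using J finite_subset by blast
  have car: "col A ` J \<subseteq> carrier_vec n"
    using A by auto
  have "lin_indpt (col A ` J)"
  proof (rule finite_lin_indpt2)
    show "finite (col A ` J)" using fin by simp
    show "col A ` J \<subseteq> carrier_vec n" by (rule car)
    fix a assume zero: "lincomb a (col A ` J) = 0\<^sub>v n"
    show "\<forall>v\<in>col A ` J. a v = 0"
    proof safe
      fix j assume j: "j \<in> J"
      obtain i where i: "i < n" "A $$ (i, j) \<noteq> 0"
        using nz j by blast
      have "0 = lincomb a (col A ` J) $ i"
        using zero i by simp
      also have "\<dots> = (\<Sum>v\<in>col A ` J. a v * v $ i)"
        using lincomb_index[OF i(1) car] .
      also have "\<dots> = (\<Sum>j'\<in>J. a (col A j') * A $$ (i, j'))"
        by (simp add: sum.reindex[OF inj] ent i(1) cong: sum.cong)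
      also have "\<dots> = (\<Sum>j'\<in>{j}. a (col A j') * A $$ (i, j'))"
        using disj[OF i(1) j _ i(2)] j fin by (intro sum.mono_neutral_right) auto
      finally show "a (col A j) = 0"
        using i(2) by simp
    qed
  qed
  moreover have "col A ` J \<subseteq> set (cols A)"
    using J A by (auto simp: cols_def)
  ultimately show ?thesis
    using rank_ge_card_indpt[OF A] card_image[OF inj] by metis
qed

end

section \<open>Looped digraphs whose out-neighbourhoods partition the vertices\<close>

text \<open>Two vertices have either the same or disjoint out-neighbourhoods, and there are neither sources
  nor sinks. Up to isomorphism, these are the line digraphs of the digraphs with a loop, without sources
  and sinks, and possibly with parallel arcs: out-neighbourhoods in a line digraph are the sets
  of arcs with a given tail.\<close>

locale looped_partition_digraph =
  fixes H :: "'a pair_pre_digraph"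
  assumes finite_verts: "finite (pverts H)"
    and arcs_in_verts: "parcs H \<subseteq> pverts H \<times> pverts H"
    and loop: "has_loop H"
    and out_nbhd_eqI: "\<And>u v w. w \<in> out_nbhd H u \<Longrightarrow> w \<in> out_nbhd H v \<Longrightarrow>
      out_nbhd H u = out_nbhd H v"
    and out_nbhd_ne: "\<And>u. u \<in> pverts H \<Longrightarrow> out_nbhd H u \<noteq> {}"
    and in_nbhd_ne: "\<And>v. v \<in> pverts H \<Longrightarrow> \<exists>u. v \<in> out_nbhd H u"
begin

abbreviation blocks :: "'a set set" where
  "blocks \<equiv> out_nbhd H ` pverts H"

lemma out_nbhd_subset: "out_nbhd H u \<subseteq> pverts H"
  using arcs_in_verts by (auto simp: out_nbhd_def)

lemma in_out_nbhd_verts: "v \<in> out_nbhd H u \<Longrightarrow> u \<in> pverts H"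
  using arcs_in_verts by (auto simp: out_nbhd_def)

lemma force_step_eq:
  "force_step H B = B \<union> {v \<in> pverts H - B. \<exists>u \<in> pverts H. out_nbhd H u - B = {v}}"
  using loop by (simp add: force_step_def)

text \<open>By disjointness, a vertex of a block can only be forced by a vertex whose out-neighbourhood is
  that block, and such a vertex needs all but one element of the block to be coloured.\<close>

lemma zf_set_deficient_block:
  assumes u: "u \<in> pverts H" and two: "\<not> card (out_nbhd H u - S) \<le> 1"
  shows "out_nbhd H u - zf_set H S m = out_nbhd H u - S"
proof (induction m)
  case (Suc m)
  have "v \<notin> out_nbhd H u"
    if w: "out_nbhd H w - zf_set H S m = {v}" for v w
  proof
    assume "v \<in> out_nbhd H u"
    moreover have "v \<in> out_nbhd H w" using w by auto
    ultimately have "out_nbhd H u = out_nbhd H w" by (rule out_nbhd_eqI)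
    then have "card (out_nbhd H u - S) = card {v}" using w Suc by simp
    with two show False by simp
  qed
  then show ?case using Suc by (auto simp: force_step_eq)
qed simp

text \<open>When no block misses two vertices, one step already colours everything.\<close>

lemma zf_set_full_iff:
  assumes S: "S \<subseteq> pverts H"
  shows "(\<exists>m. zf_set H S m = pverts H) \<longleftrightarrow> (\<forall>u \<in> pverts H. card (out_nbhd H u - S) \<le> 1)"
proof
  assume "\<exists>m. zf_set H S m = pverts H"
  then obtain m where m: "zf_set H S m = pverts H" ..
  show "\<forall>u \<in> pverts H. card (out_nbhd H u - S) \<le> 1"
  proof (rule ballI, rule ccontr)
    fix u assume "u \<in> pverts H" and two: "\<not> card (out_nbhd H u - S) \<le> 1"
    from zf_set_deficient_block[OF this, of m] have "out_nbhd H u - S = {}"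
      using m out_nbhd_subset by auto
    with two show False by (metis card.empty le0)
  qed
next
  assume one: "\<forall>u \<in> pverts H. card (out_nbhd H u - S) \<le> 1"
  have "v \<in> force_step H S" if v: "v \<in> pverts H" "v \<notin> S" for v
  proof -
    obtain u where u: "v \<in> out_nbhd H u" using in_nbhd_ne v by blast
    then have "u \<in> pverts H" by (rule in_out_nbhd_verts)
    moreover have "finite (out_nbhd H u)"
      using out_nbhd_subset finite_verts by (rule finite_subset)
    ultimately have "\<forall>a \<in> out_nbhd H u - S. \<forall>b \<in> out_nbhd H u - S. a = b"
      using one card_le_Suc0_iff_eq[of "out_nbhd H u - S"] by auto
    then have "out_nbhd H u - S = {v}" using u v by blast
    then show ?thesis using v \<open>u \<in> pverts H\<close> by (auto simp: force_step_eq)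
  qed
  then have "zf_set H S 1 = pverts H"
    using S by (auto simp: force_step_eq)
  then show "\<exists>m. zf_set H S m = pverts H" ..
qed

text \<open>Power domination is zero forcing from the closed out-neighbourhood, delayed by one step.\<close>

lemma pd_set_Suc: "pd_set H S (Suc t) = zf_set H (closed_out_nbhd H S) t"
  by (induction t) simp_all

lemma closed_out_nbhd_subset: "S \<subseteq> pverts H \<Longrightarrow> closed_out_nbhd H S \<subseteq> pverts H"
  using out_nbhd_subset by (auto simp: closed_out_nbhd_def)

lemma power_dominating_set_iff:
  "power_dominating_set H S \<longleftrightarrow> S \<noteq> {} \<and> S \<subseteq> pverts H \<and>
    (\<forall>u \<in> pverts H. card (out_nbhd H u - closed_out_nbhd H S) \<le> 1)"
proof -
  have "(\<exists>t. pd_set H S t = pverts H) \<longleftrightarrow> (\<exists>t. zf_set H (closed_out_nbhd H S) t = pverts H)"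
    if S: "S \<subseteq> pverts H"
  proof
    assume "\<exists>t. pd_set H S t = pverts H"
    then obtain t where t: "pd_set H S t = pverts H" ..
    show "\<exists>t. zf_set H (closed_out_nbhd H S) t = pverts H"
    proof (cases t)
      \<comment> \<open>step \<open>0\<close> precedes the domination step, but then \<open>S\<close> is already everything\<close>
      case 0
      then have "pverts H \<subseteq> closed_out_nbhd H S"
        using t by (auto simp: closed_out_nbhd_def)
      then have "zf_set H (closed_out_nbhd H S) 0 = pverts H"
        using closed_out_nbhd_subset[OF S] by auto
      then show ?thesis ..
    qed (use t pd_set_Suc in auto)
  qed (metis pd_set_Suc)
  then show ?thesis
    using zf_set_full_iff closed_out_nbhd_subset by (auto simp: power_dominating_set_def)
qed

lemma ex_representatives:
  "\<exists>r. (\<forall>C \<in> blocks. r C \<in> C) \<and> inj_on r blocks \<and> r ` blocks \<subseteq> pverts H"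
proof -
  have "\<forall>C \<in> blocks. \<exists>v. v \<in> C" using out_nbhd_ne by blast
  then obtain r where r: "\<forall>C \<in> blocks. r C \<in> C" by metis
  have "inj_on r blocks"
  proof (rule inj_onI)
    fix B C assume "B \<in> blocks" "C \<in> blocks" "r B = r C"
    then have "r B \<in> B" "r B \<in> C" using r by auto
    with \<open>B \<in> blocks\<close> \<open>C \<in> blocks\<close> show "B = C" using out_nbhd_eqI by blast
  qed
  moreover have "r ` blocks \<subseteq> pverts H" using r out_nbhd_subset by blast
  ultimately show ?thesis using r by blast
qed

theorem zero_forcing_number_eq:
  assumes "card blocks < card (pverts H)"
  shows "zero_forcing_number H = card (pverts H) - card blocks"
proof -
  have "{card S | S. zero_forcing_set H S} \<subseteq> {..card (pverts H)}"
    using finite_verts by (auto simp: zero_forcing_set_def card_mono)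
  then have fin: "finite {card S | S. zero_forcing_set H S}"
    by (rule finite_subset) simp
  have lower: "card (pverts H) - card blocks \<le> card S" if zf: "zero_forcing_set H S" for S
  proof -
    have S: "S \<subseteq> pverts H" and one: "\<forall>u \<in> pverts H. card (out_nbhd H u - S) \<le> 1"
      using zf zf_set_full_iff by (auto simp: zero_forcing_set_def)
    have "pverts H - S \<subseteq> (\<Union>C\<in>blocks. C - S)"
    proof
      fix v assume v: "v \<in> pverts H - S"
      then obtain u where u: "v \<in> out_nbhd H u" using in_nbhd_ne by blast
      then have "out_nbhd H u \<in> blocks" using in_out_nbhd_verts by (intro imageI)
      then show "v \<in> (\<Union>C\<in>blocks. C - S)" using u v by blast
    qed
    moreover have "(\<Union>C\<in>blocks. C - S) \<subseteq> pverts H" using out_nbhd_subset by blast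
    then have "finite (\<Union>C\<in>blocks. C - S)" using finite_verts by (rule finite_subset)
    ultimately have "card (pverts H - S) \<le> card (\<Union>C\<in>blocks. C - S)"
      by (intro card_mono)
    also have "\<dots> \<le> (\<Sum>C\<in>blocks. card (C - S))"
      using finite_verts by (intro card_UN_le) simp
    also have "\<dots> \<le> (\<Sum>C\<in>blocks. 1)"
      using one by (intro sum_mono) auto
    finally have "card (pverts H - S) \<le> card blocks" by simp
    then show ?thesis
      using card_Diff_subset[OF finite_subset[OF S finite_verts] S] by linarith
  qed
  obtain r where r: "\<forall>C \<in> blocks. r C \<in> C" "inj_on r blocks" "r ` blocks \<subseteq> pverts H"
    using ex_representatives by blast
  \<comment> \<open>leave out exactly one vertex of every block\<close>
  define S where "S = pverts H - r ` blocks"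
  have card_S: "card S = card (pverts H) - card blocks"
    using r finite_verts by (simp add: S_def card_Diff_subset card_image finite_subset)
  have "card (out_nbhd H u - S) \<le> 1" if u: "u \<in> pverts H" for u
  proof -
    have "v = r (out_nbhd H u)" if v: "v \<in> out_nbhd H u" "v \<notin> S" for v
    proof -
      obtain C where C: "C \<in> blocks" "v = r C"
        using v out_nbhd_subset by (auto simp: S_def)
      then have "v \<in> C" using r(1) by blast
      then have "C = out_nbhd H u"
        using C(1) v(1) out_nbhd_eqI by blast
      then show ?thesis using C by simp
    qed
    then have "out_nbhd H u - S \<subseteq> {r (out_nbhd H u)}" by auto
    from card_mono[OF _ this] show ?thesis by simp
  qed
  moreover have "S \<subseteq> pverts H" by (auto simp: S_def)
  moreover have "S \<noteq> {}" using card_S assms by auto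
  ultimately have "zero_forcing_set H S"
    using zf_set_full_iff by (simp add: zero_forcing_set_def)
  then show ?thesis
    unfolding zero_forcing_number_def
    using lower by (intro Min_eqI[OF fin]) (auto simp flip: card_S)
qed

text \<open>The columns of a system of representatives of the blocks have disjoint supports.\<close>

lemma rank_ge_card_blocks:
  assumes "X \<in> matrices_of H"
  shows "card blocks \<le> vec_space.rank (card (pverts H)) X"
proof -
  define p where "p = card (pverts H)"
  obtain f where X: "X \<in> carrier_mat p p" and f: "bij_betw f {..<p} (pverts H)"
    and nz: "\<And>i j. i < p \<Longrightarrow> j < p \<Longrightarrow> X $$ (i, j) \<noteq> 0 \<longleftrightarrow> f j \<in> out_nbhd H (f i)"
    using assms loop by (auto simp: matrices_of_def p_def out_nbhd_def)
  obtain r where r: "\<forall>C \<in> blocks. r C \<in> C" "inj_on r blocks" "r ` blocks \<subseteq> pverts H"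
    using ex_representatives by blast
  define g where "g = inv_into {..<p} f"
  have g: "g v < p" "f (g v) = v" if "v \<in> pverts H" for v
    using that f unfolding g_def
    by (metis bij_betw_imp_surj_on inv_into_into lessThan_iff)
      (metis that f bij_betw_imp_surj_on f_inv_into_f g_def)
  define J where "J = g ` r ` blocks"
  have inj: "inj_on g (r ` blocks)"
    using g(2) r(3) by (intro inj_on_inverseI[of _ f]) auto
  have J: "j < p \<and> (\<exists>u \<in> pverts H. j = g (r (out_nbhd H u)) \<and> f j \<in> out_nbhd H u)"
    if "j \<in> J" for j
  proof -
    obtain u where u: "u \<in> pverts H" "j = g (r (out_nbhd H u))"
      using \<open>j \<in> J\<close> by (auto simp: J_def)
    have "r (out_nbhd H u) \<in> out_nbhd H u" using r(1) u(1) by blast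
    moreover from this have "r (out_nbhd H u) \<in> pverts H" using out_nbhd_subset by blast
    ultimately show ?thesis using u g by metis
  qed
  have "card J \<le> vec_space.rank p X"
  proof (rule vec_space.rank_ge_card_disjoint_cols[OF X])
    show "J \<subseteq> {..<p}" using J by blast
    show "\<exists>i<p. X $$ (i, j) \<noteq> 0" if j: "j \<in> J" for j
    proof -
      obtain u where "u \<in> pverts H" "f j \<in> out_nbhd H u" "j < p" using J[OF j] by blast
      then show ?thesis using nz[of "g u" j] g[of u] by auto
    qed
    fix i j j' assume i: "i < p" and j: "j \<in> J" and j': "j' \<in> J"
      and "X $$ (i, j) \<noteq> 0" "X $$ (i, j') \<noteq> 0"
    then have *: "f j \<in> out_nbhd H (f i)" "f j' \<in> out_nbhd H (f i)"
      using nz J by blast+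
    obtain u u' where u: "j = g (r (out_nbhd H u))" "f j \<in> out_nbhd H u"
      and u': "j' = g (r (out_nbhd H u'))" "f j' \<in> out_nbhd H u'"
      using J[OF j] J[OF j'] by blast
    have "out_nbhd H u = out_nbhd H u'"
      using out_nbhd_eqI[OF u(2) *(1)] out_nbhd_eqI[OF u'(2) *(2)] by simp
    then show "j = j'" using u(1) u'(1) by simp
  qed
  then show ?thesis
    using inj r(2) by (simp add: J_def card_image p_def)
qed

text \<open>In the adjacency matrix, the column of \<open>v\<close> only depends on the block of \<open>v\<close>.\<close>

lemma obtain_rank_le_card_blocks:
  obtains X where "X \<in> matrices_of H" "vec_space.rank (card (pverts H)) X \<le> card blocks"
proof -
  define p where "p = card (pverts H)"
  obtain f where f: "bij_betw f {..<p} (pverts H)"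
    using ex_bij_betw_nat_finite[OF finite_verts] by (auto simp: p_def atLeast0LessThan)
  define X :: "real mat" where
    "X = mat p p (\<lambda>(i, j). if f j \<in> out_nbhd H (f i) then 1 else 0)"
  have X: "X \<in> carrier_mat p p" by (simp add: X_def)
  have "X \<in> matrices_of H"
    using f unfolding matrices_of_def p_def[symmetric] by (auto simp: X_def out_nbhd_def)
  moreover have "set (cols X) \<subseteq> (\<lambda>C. vec p (\<lambda>i. if C = out_nbhd H (f i) then 1 else 0)) ` blocks"
  proof
    fix x assume "x \<in> set (cols X)"
    then obtain j where j: "j < p" "x = col X j" using X by (auto simp: cols_def)
    then have "f j \<in> pverts H" using f by (auto simp: bij_betw_def)
    then obtain u where u: "f j \<in> out_nbhd H u" using in_nbhd_ne by blast
    have "f j \<in> out_nbhd H w \<longleftrightarrow> out_nbhd H u = out_nbhd H w" for w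
      using u out_nbhd_eqI by blast
    then have "x = vec p (\<lambda>i. if out_nbhd H u = out_nbhd H (f i) then 1 else 0)"
      using j by (auto simp: X_def)
    then show "x \<in> (\<lambda>C. vec p (\<lambda>i. if C = out_nbhd H (f i) then 1 else 0)) ` blocks"
      using in_out_nbhd_verts[OF u] by blast
  qed
  then have "card (set (cols X)) \<le> card blocks"
    by (meson finite_verts finite_imageI surj_card_le)
  ultimately show ?thesis
    using that vec_space.rank_le_card_cols[OF X] by (simp add: p_def)
qed

lemma matrices_of_carrier:
  "X \<in> matrices_of H \<Longrightarrow> X \<in> carrier_mat (card (pverts H)) (card (pverts H))"
  unfolding matrices_of_def by blast

lemma kernel_dim_eq:
  assumes "X \<in> matrices_of H"
  shows "kernel_dim X = card (pverts H) - vec_space.rank (card (pverts H)) X"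
  using vec_space.rank_plus_kernel_dim[OF matrices_of_carrier[OF assms]] by linarith

theorem min_rank_eq: "min_rank H = card blocks"
proof -
  have "{vec_space.rank (card (pverts H)) X | X. X \<in> matrices_of H} \<subseteq> {..card (pverts H)}"
    using vec_space.rank_le_nc matrices_of_carrier by blast
  then have fin: "finite {vec_space.rank (card (pverts H)) X | X. X \<in> matrices_of H}"
    by (rule finite_subset) simp
  obtain X where "X \<in> matrices_of H" "vec_space.rank (card (pverts H)) X \<le> card blocks"
    by (rule obtain_rank_le_card_blocks)
  then show ?thesis
    unfolding min_rank_def using rank_ge_card_blocks
    by (intro Min_eqI[OF fin]) (auto intro!: exI[of _ X] antisym)
qed

theorem max_nullity_eq: "max_nullity H = card (pverts H) - card blocks"
proof -
  have "{kernel_dim X | X. X \<in> matrices_of H} \<subseteq> {..card (pverts H)}"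
    using kernel_dim_eq by auto
  then have fin: "finite {kernel_dim X | X. X \<in> matrices_of H}"
    by (rule finite_subset) simp
  obtain X where X: "X \<in> matrices_of H" "vec_space.rank (card (pverts H)) X \<le> card blocks"
    by (rule obtain_rank_le_card_blocks)
  then have "vec_space.rank (card (pverts H)) X = card blocks"
    using rank_ge_card_blocks by (simp add: antisym)
  then show ?thesis
    unfolding max_nullity_def using rank_ge_card_blocks X kernel_dim_eq
    by (intro Max_eqI[OF fin]) (auto intro!: exI[of _ X] diff_le_mono2)
qed

end

section \<open>De Bruijn digraphs\<close>

lemma pverts_de_bruijn [simp]: "pverts (de_bruijn d D) = {..<d ^ D}"
  by (simp add: de_bruijn_def)

lemma out_nbhd_de_bruijn:
  assumes "D > 0"
  shows "out_nbhd (de_bruijn d D) x =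
    (if x < d ^ D then {d * (x mod d ^ (D - 1))..<d * (x mod d ^ (D - 1)) + d} else {})"
proof -
  have "(d * x + t) mod d ^ D = d * (x mod d ^ (D - 1)) + t" if "t < d" for t
  proof -
    have "d ^ D = d * d ^ (D - 1)" using assms by (cases D) auto
    then show ?thesis using that by (simp add: mod_mult2_eq)
  qed
  then have "(\<lambda>t. (d * x + t) mod d ^ D) ` {0..<d} = (+) (d * (x mod d ^ (D - 1))) ` {0..<d}"
    by (intro image_cong) auto
  moreover have "out_nbhd (de_bruijn d D) x =
      (if x < d ^ D then (\<lambda>t. (d * x + t) mod d ^ D) ` {0..<d} else {})"
    by (auto simp: out_nbhd_def de_bruijn_def)
  ultimately show ?thesis by (simp add: image_add_atLeastLessThan add.commute)
qed

lemma in_block_iff: "y \<in> {d * c..<d * c + d} \<longleftrightarrow> d > 0 \<and> y div d = c" for c d y :: nat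
proof (cases "d = 0")
  case False
  have "y div d = c" if "d * c \<le> y" "y < d * c + d"
    using that by (intro div_nat_eqI) (simp_all add: algebra_simps)
  then show ?thesis using False dividend_less_times_div[of d y] by auto
qed simp

lemma blocks_de_bruijn:
  assumes d: "d > 0" and D: "D > 0"
  shows "out_nbhd (de_bruijn d D) ` {..<d ^ D} = (\<lambda>c. {d * c..<d * c + d}) ` {..<d ^ (D - 1)}"
proof -
  have "d ^ (D - 1) \<le> d ^ D" using d by (intro power_increasing) auto
  then have "c \<in> (\<lambda>x. x mod d ^ (D - 1)) ` {..<d ^ D}" if "c < d ^ (D - 1)" for c
    using that by (intro image_eqI[of _ _ c]) auto
  then have "(\<lambda>x. x mod d ^ (D - 1)) ` {..<d ^ D} = {..<d ^ (D - 1)}"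
    using d by auto
  moreover have "out_nbhd (de_bruijn d D) ` {..<d ^ D} =
      (\<lambda>c. {d * c..<d * c + d}) ` (\<lambda>x. x mod d ^ (D - 1)) ` {..<d ^ D}"
    unfolding image_image using D by (intro image_cong) (auto simp: out_nbhd_de_bruijn)
  ultimately show ?thesis by simp
qed

lemma card_blocks_de_bruijn:
  assumes "d > 0" "D > 0"
  shows "card (out_nbhd (de_bruijn d D) ` {..<d ^ D}) = d ^ (D - 1)"
proof -
  have "inj_on (\<lambda>c. {d * c..<d * c + d}) {..<d ^ (D - 1)}"
  proof (rule inj_onI)
    fix b c :: nat assume "{d * b..<d * b + d} = {d * c..<d * c + d}"
    moreover have "d * b \<in> {d * b..<d * b + d}" using assms by simp
    ultimately have "d * b \<in> {d * c..<d * c + d}" by blast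
    then have "d * b div d = c" unfolding in_block_iff ..
    then show "b = c" using assms by simp
  qed
  then show ?thesis by (simp add: blocks_de_bruijn[OF assms] card_image)
qed

lemma looped_partition_digraph_de_bruijn:
  assumes "d > 0" "D > 0"
  shows "looped_partition_digraph (de_bruijn d D)"
proof
  have pow: "d ^ D = d * d ^ (D - 1)" using assms by (cases D) auto
  show "finite (pverts (de_bruijn d D))" by simp
  show "parcs (de_bruijn d D) \<subseteq> pverts (de_bruijn d D) \<times> pverts (de_bruijn d D)"
    using assms by (auto simp: de_bruijn_def)
  show "has_loop (de_bruijn d D)"
    using assms by (auto simp: has_loop_def de_bruijn_def intro!: bexI[of _ 0] exI[of _ 0])
  show "out_nbhd (de_bruijn d D) u = out_nbhd (de_bruijn d D) v"
    if "w \<in> out_nbhd (de_bruijn d D) u" "w \<in> out_nbhd (de_bruijn d D) v" for u v w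
  proof -
    have "w div d = x mod d ^ (D - 1) \<and> x < d ^ D" if "w \<in> out_nbhd (de_bruijn d D) x" for x
      using that unfolding out_nbhd_de_bruijn[OF assms(2)]
      by (simp only: in_block_iff empty_iff simp_thms split: if_splits)
    with that have "u mod d ^ (D - 1) = v mod d ^ (D - 1)" "u < d ^ D" "v < d ^ D" by metis+
    then show ?thesis by (simp add: out_nbhd_de_bruijn[OF assms(2)])
  qed
  show "out_nbhd (de_bruijn d D) u \<noteq> {}" if "u \<in> pverts (de_bruijn d D)" for u
    using that assms by (simp add: out_nbhd_de_bruijn)
  show "\<exists>u. v \<in> out_nbhd (de_bruijn d D) u" if "v \<in> pverts (de_bruijn d D)" for v
  proof -
    have "v div d < d ^ (D - 1)"
      using that pow by (simp add: less_mult_imp_div_less mult.commute)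
    moreover have "v div d < d ^ D"
      using that by (simp add: le_less_trans[OF div_le_dividend])
    ultimately show ?thesis
      using assms unfolding out_nbhd_de_bruijn[OF assms(2)]
      by (intro exI[of _ "v div d"]) (simp only: in_block_iff mod_less if_True simp_thms)
  qed
qed

lemma closed_out_nbhd_de_bruijn:
  assumes "D > 0" "S \<subseteq> {..<d ^ D}"
  shows "closed_out_nbhd (de_bruijn d D) S =
    S \<union> (\<Union>c \<in> (\<lambda>x. x mod d ^ (D - 1)) ` S. {d * c..<d * c + d})"
proof -
  have "closed_out_nbhd (de_bruijn d D) S = S \<union> (\<Union>x\<in>S. out_nbhd (de_bruijn d D) x)"
    by (auto simp: closed_out_nbhd_def)
  also have "(\<Union>x\<in>S. out_nbhd (de_bruijn d D) x) =
      (\<Union>x\<in>S. {d * (x mod d ^ (D - 1))..<d * (x mod d ^ (D - 1)) + d})"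
    using assms by (intro SUP_cong) (auto simp: out_nbhd_de_bruijn)
  finally show ?thesis by simp
qed

lemma power_dominating_set_de_bruijn_iff:
  assumes d: "d > 0" and D: "D > 0" and S: "S \<subseteq> {..<d ^ D}"
  shows "power_dominating_set (de_bruijn d D) S \<longleftrightarrow> S \<noteq> {} \<and>
    (\<forall>c < d ^ (D - 1). c \<in> (\<lambda>x. x mod d ^ (D - 1)) ` S \<or> card ({d * c..<d * c + d} - S) \<le> 1)"
proof -
  interpret looped_partition_digraph "de_bruijn d D"
    using d D by (rule looped_partition_digraph_de_bruijn)
  define C where "C = (\<lambda>x. x mod d ^ (D - 1)) ` S"
  define T where "T = closed_out_nbhd (de_bruijn d D) S"
  have T: "T = S \<union> (\<Union>c\<in>C. {d * c..<d * c + d})"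
    unfolding T_def C_def using closed_out_nbhd_de_bruijn D S .
  have "card ({d * c..<d * c + d} - T) \<le> 1 \<longleftrightarrow> c \<in> C \<or> card ({d * c..<d * c + d} - S) \<le> 1" for c
  proof (cases "c \<in> C")
    case True
    then have "{d * c..<d * c + d} - T = {}" unfolding T by blast
    then show ?thesis using True by (simp only: card.empty) simp
  next
    case False
    have "y \<notin> {d * b..<d * b + d}" if "b \<in> C" "y \<in> {d * c..<d * c + d}" for b y
      using that False unfolding in_block_iff by auto
    then have "{d * c..<d * c + d} - T = {d * c..<d * c + d} - S"
      unfolding T by blast
    then show ?thesis using False by simp
  qed
  moreover have "(\<forall>B \<in> out_nbhd (de_bruijn d D) ` {..<d ^ D}. card (B - T) \<le> 1) \<longleftrightarrow>
      (\<forall>B \<in> (\<lambda>c. {d * c..<d * c + d}) ` {..<d ^ (D - 1)}. card (B - T) \<le> 1)"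
    unfolding blocks_de_bruijn[OF d D] ..
  then have "(\<forall>u \<in> {..<d ^ D}. card (out_nbhd (de_bruijn d D) u - T) \<le> 1) \<longleftrightarrow>
      (\<forall>c \<in> {..<d ^ (D - 1)}. card ({d * c..<d * c + d} - T) \<le> 1)"
    by (simp only: ball_simps)
  ultimately show ?thesis
    using S unfolding power_dominating_set_iff T_def[symmetric] C_def[symmetric]
    by (simp add: Ball_def)
qed

text \<open>If \<open>S\<close> were smaller than \<open>(d - 1) * J\<close>, with \<open>J = d ^ (D - 2)\<close>, its residues would leave at least
  \<open>J\<close> of the \<open>d * J\<close> blocks undominated, and each of these needs \<open>d - 1\<close> elements of \<open>S\<close> of its own.\<close>

lemma card_power_dominating_set_de_bruijn_ge:
  assumes d: "d > 0" and D: "D \<ge> 2" and pd: "power_dominating_set (de_bruijn d D) S"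
  shows "(d - 1) * d ^ (D - 2) \<le> card S"
proof (rule ccontr)
  define K where "K = d ^ (D - 1)"
  define J where "J = d ^ (D - 2)"
  define C where "C = (\<lambda>x. x mod K) ` S"
  have "D - 1 = Suc (D - 2)" using D by simp
  then have KJ: "K = d * J" by (simp add: K_def J_def)
  have K: "K > 0" using d by (simp add: K_def)
  have S: "S \<subseteq> {..<d ^ D}" using pd by (simp add: power_dominating_set_def)
  then have fin: "finite S" by (rule finite_subset) simp
  have C: "card C \<le> card S" "C \<subseteq> {..<K}"
    using fin K by (auto simp: C_def card_image_le)
  assume "\<not> (d - 1) * d ^ (D - 2) \<le> card S"
  then have less: "card S < (d - 1) * J" by (simp add: J_def)
  have "(d - 1) * J + J = K" using d by (cases d) (auto simp: KJ)
  then have "J \<le> card ({..<K} - C)"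
    using less C by (simp add: card_Diff_subset finite_subset[OF C(2)])
  then have "(d - 1) * J \<le> (\<Sum>c\<in>{..<K} - C. d - 1)" by simp
  also have "\<dots> \<le> (\<Sum>c\<in>{..<K} - C. card (S \<inter> {d * c..<d * c + d}))"
  proof (rule sum_mono)
    fix c assume "c \<in> {..<K} - C"
    then have one: "card ({d * c..<d * c + d} - S) \<le> 1"
      using pd power_dominating_set_de_bruijn_iff[OF d _ S] D by (auto simp: C_def K_def)
    have "card ({d * c..<d * c + d} - S) = d - card (S \<inter> {d * c..<d * c + d})"
      by (subst card_Diff_subset_Int) (auto simp: Int_commute)
    then show "d - 1 \<le> card (S \<inter> {d * c..<d * c + d})" using one by linarith
  qed
  also have "\<dots> = card (\<Union>c\<in>{..<K} - C. S \<inter> {d * c..<d * c + d})"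
  proof (rule card_UN_disjoint[symmetric])
    show "\<forall>b\<in>{..<K} - C. \<forall>c\<in>{..<K} - C. b \<noteq> c \<longrightarrow>
        (S \<inter> {d * b..<d * b + d}) \<inter> (S \<inter> {d * c..<d * c + d}) = {}"
      using in_block_iff[of _ d] by (metis IntE equals0I)
  qed (use fin in auto)
  also have "\<dots> \<le> card S" using fin by (intro card_mono) auto
  finally show False using less by simp
qed

text \<open>Digits are base \<open>d\<close>. If \<open>D \<ge> 3\<close>, then \<open>\<phi> j\<close> appends to the word \<open>j\<close> of length \<open>D - 2\<close> its own
  first digit; so the values of \<open>\<phi>\<close> are the words of length \<open>D - 1\<close> whose first and last digits agree.
  Removing the first digit instead of the last one, \<open>\<phi> j mod J\<close> again runs through all
  words of length \<open>D - 2\<close>. The vertex \<open>d * \<phi> j + t\<close> of block \<open>\<phi> j\<close> dominates the block whose index is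
  \<open>\<phi> j mod J\<close> followed by the digit \<open>t\<close>. This is a value of \<open>\<phi>\<close> only if \<open>t = \<tau> j\<close>, so omitting
  that single vertex from each block \<open>\<phi> j\<close> loses no block outside the range of \<open>\<phi>\<close>.\<close>

lemma ex_power_dominating_set_de_bruijn:
  assumes d: "d \<ge> 2" and D: "D \<ge> 2"
  shows "\<exists>S. power_dominating_set (de_bruijn d D) S \<and> card S \<le> (d - 1) * d ^ (D - 2)"
proof -
  define K where "K = d ^ (D - 1)"
  define J where "J = d ^ (D - 2)"
  \<comment> \<open>for \<open>D = 2\<close>, truncated subtraction makes \<open>I = J = 1\<close>, and then \<open>\<phi> 0 = \<tau> 0 = 0\<close>\<close>
  define I where "I = d ^ (D - 3)"
  define \<phi> where "\<phi> j = d * j + j div I" for j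
  define \<tau> where "\<tau> j = (\<phi> j mod J) div I" for j
  define S where "S = (\<lambda>(j, t). d * \<phi> j + t) ` (SIGMA j:{..<J}. {..<d} - {\<tau> j})"
  have pos: "J > 0" "I > 0" using d by (simp_all add: J_def I_def)
  have "D = Suc (D - 1)" "D - 1 = Suc (D - 2)" using D by simp_all
  then have N: "d ^ D = d * K" and KJ: "K = d * J"
    unfolding K_def J_def by (metis power_Suc)+
  have JI: "J = 1 \<and> I = 1 \<or> J = d * I"
  proof (cases "D = 2")
    case False
    then have "D - 2 = Suc (D - 3)" using D by simp
    then show ?thesis by (simp add: J_def I_def)
  qed (simp add: J_def I_def)
  have digit: "j div I < d" if "j < J" for j
    using that JI d by (auto simp: less_mult_imp_div_less)
  have \<tau>: "\<tau> j < d" for j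
    unfolding \<tau>_def using pos by (intro digit) simp
  have \<phi>: "\<phi> j < K" if "j < J" for j
  proof -
    have "\<phi> j < d * Suc j" using digit[OF that] by (simp add: \<phi>_def)
    also have "\<dots> \<le> K" unfolding KJ using that by (intro mult_le_mono2) simp
    finally show ?thesis .
  qed
  have onto: "\<exists>j < J. \<phi> j mod J = i" if i: "i < J" for i
    using JI
  proof
    assume "J = 1 \<and> I = 1"
    then show ?thesis using i by auto
  next
    assume J: "J = d * I"
    \<comment> \<open>\<open>j\<close> is the word \<open>i\<close> with its last digit moved to the front\<close>
    define j where "j = (i mod d) * I + i div d"
    have q: "i div d < I"
      using i J by (simp add: less_mult_imp_div_less mult.commute)
    then have "j div I = i mod d" using pos by (simp add: j_def)
    then have "\<phi> j = J * (i mod d) + i"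
      using J by (simp add: \<phi>_def j_def algebra_simps)
    then have "\<phi> j mod J = i" using i by simp
    moreover have "j < J"
    proof -
      have "j < Suc (i mod d) * I" using q by (simp add: j_def)
      also have "\<dots> \<le> d * I" using d by (intro mult_le_mono1) (simp add: Suc_leI)
      finally show ?thesis using J by simp
    qed
    ultimately show ?thesis by blast
  qed
  have fin: "finite (SIGMA j:{..<J}. {..<d} - {\<tau> j})" by simp
  have "card S \<le> card (SIGMA j:{..<J}. {..<d} - {\<tau> j})"
    unfolding S_def using fin by (rule card_image_le)
  also have "\<dots> = (\<Sum>j<J. d - 1)"
    using \<tau> by (subst card_SigmaI) auto
  finally have card: "card S \<le> (d - 1) * J" by (simp add: mult.commute)
  have sub: "S \<subseteq> {..<d ^ D}"
  proof
    fix x assume "x \<in> S"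
    then obtain j t where j: "j < J" "t < d" and x: "x = d * \<phi> j + t" by (auto simp: S_def)
    have "x < d * Suc (\<phi> j)" using j x by simp
    also have "\<dots> \<le> d ^ D" unfolding N using \<phi>[OF j(1)] by (intro mult_le_mono2) simp
    finally show "x \<in> {..<d ^ D}" by simp
  qed
  have "c \<in> (\<lambda>x. x mod K) ` S \<or> card ({d * c..<d * c + d} - S) \<le> 1" if c: "c < K" for c
  proof (cases "c \<in> \<phi> ` {..<J}")
    case True
    then obtain j where j: "j < J" "c = \<phi> j" by blast
    have "y = d * c + \<tau> j" if y: "y \<in> {d * c..<d * c + d}" "y \<notin> S" for y
    proof (rule ccontr)
      assume ne: "y \<noteq> d * c + \<tau> j"
      obtain t where t: "y = d * c + t" "t < d"
        using y(1) le_Suc_ex by auto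
      with ne j have "(j, t) \<in> (SIGMA j:{..<J}. {..<d} - {\<tau> j})" by auto
      then have "y \<in> S" unfolding S_def using t(1) j(2) by force
      with y show False by simp
    qed
    then have "{d * c..<d * c + d} - S \<subseteq> {d * c + \<tau> j}" by blast
    from card_mono[OF _ this] show ?thesis by simp
  next
    case False
    have "c div d < J" using c KJ by (simp add: less_mult_imp_div_less mult.commute)
    with onto obtain j where j: "j < J" "\<phi> j mod J = c div d" by blast
    have "c mod d \<noteq> \<tau> j"
    proof
      assume "c mod d = \<tau> j"
      then have "c = \<phi> (c div d)"
        using j(2) by (simp add: \<phi>_def \<tau>_def) (metis mult_div_mod_eq)
      then show False using False \<open>c div d < J\<close> by blast
    qed
    then have "d * \<phi> j + c mod d \<in> S"
      unfolding S_def using j(1) d by force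
    moreover have "(d * \<phi> j + c mod d) mod K = c"
      using j(2) d by (simp add: KJ mod_mult2_eq)
    ultimately show ?thesis by (metis imageI)
  qed
  moreover have "S \<noteq> {}"
  proof
    assume "S = {}"
    then have "{..<d} \<subseteq> {\<tau> 0}" using pos by (auto simp: S_def)
    from card_mono[OF _ this] show False using d by simp
  qed
  ultimately have "power_dominating_set (de_bruijn d D) S"
    using power_dominating_set_de_bruijn_iff[OF _ _ sub] d D by (simp add: K_def)
  then show ?thesis using card by (auto simp: J_def)
qed

lemma power_domination_number_de_bruijn:
  assumes d: "d \<ge> 2" and D: "D \<ge> 2"
  shows "power_domination_number (de_bruijn d D) = (d - 1) * d ^ (D - 2)"
proof -
  have "{card S | S. power_dominating_set (de_bruijn d D) S} \<subseteq> card ` Pow {..<d ^ D}"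
    by (auto simp: power_dominating_set_def)
  then have fin: "finite {card S | S. power_dominating_set (de_bruijn d D) S}"
    by (rule finite_subset) simp
  have lower: "(d - 1) * d ^ (D - 2) \<le> card S" if "power_dominating_set (de_bruijn d D) S" for S
    using card_power_dominating_set_de_bruijn_ge that d D by simp
  obtain S where "power_dominating_set (de_bruijn d D) S" "card S = (d - 1) * d ^ (D - 2)"
    using ex_power_dominating_set_de_bruijn[OF assms] lower by (metis order_antisym)
  then show ?thesis
    unfolding power_domination_number_def using lower by (intro Min_eqI[OF fin]) (auto, metis)
qed

theorem corollary5p1:
  fixes d D :: nat
  assumes "d \<ge> 2" and "D \<ge> 2"
  shows "zero_forcing_number (de_bruijn d D) = (d - 1) * d ^ (D - 1) \<and>
         max_nullity (de_bruijn d D) = (d - 1) * d ^ (D - 1) \<and>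
         min_rank (de_bruijn d D) = d ^ (D - 1) \<and>
         power_domination_number (de_bruijn d D) = (d - 1) * d ^ (D - 2)"
proof -
  interpret looped_partition_digraph "de_bruijn d D"
    using assms by (intro looped_partition_digraph_de_bruijn) auto
  have blocks: "card blocks = d ^ (D - 1)"
    using assms by (simp add: card_blocks_de_bruijn)
  have pow: "d ^ D = d * d ^ (D - 1)" using assms by (cases D) auto
  then have diff: "d ^ D - d ^ (D - 1) = (d - 1) * d ^ (D - 1)"
    by (simp add: diff_mult_distrib)
  have "d ^ (D - 1) < d ^ D" using assms by (intro power_strict_increasing) auto
  then show ?thesis
    using zero_forcing_number_eq max_nullity_eq min_rank_eq blocks diff
      power_domination_number_de_bruijn[OF assms] by simp
qed

end
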